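(* Let $\mathscr H=(V,E)$ be a hypergraph such that its associated bipartite graph $\mathrm{Bip}\,\mathscr H$ is connected. The hypertrees $f\colon E\to\mathbf N$ of $\mathscr H$ are exactly the integer solutions $f\in\mathbf Z^E$ of the following system of linear inequalities in $\mathbf R^E$: \begin{align*} f(e)&\ge 0 &&\text{for all } e\in E,\\ \sum_{e\in E'}f(e)&\le \Bigl|\bigcup E'\Bigr|-c(E') &&\text{for all non-empty } E'\subset E,\\ \sum_{e\in E}f(e)&=|V|-1. \end{align*}
   Context: A hypergraph is a pair $\mathscr H=(V,E)$ with $V$ a finite set (vertices) and $E$ a finite multiset of non-empty subsets of $V$ (hyperedges). Its associated bipartite graph $\mathrm{Bip}\,\mathscr H$ has color classes $V$ and $E$, with $v\in V$ joined to $e\in E$ by an edge iff $v\in e$. $\mathbf N=\{0,1,2,\ldots\}$. When $\mathrm{Bip}\,\mathscr H$ is connected, a hypertree in $\mathscr H$ is a function $f\colon E\to\mathbf N$ such that there is a spanning tree of $\mathrm{Bip}\,\mathscr H$ having degree $f(e)+1$ at each $e\in E$. For a non-empty $E'\subset E$, $\bigcup E'\subset V$ is the set of neighbors of $E'$ in $\mathrm{Bip}\,\mathscr H$ (i.e. the union of the hyperedges in $E'$); $\mathrm{Bip}\,\mathscr H|_{E'}$ is the bipartite graph with color classes $E'$ and $\bigcup E'$ and all edges inherited from $\mathrm{Bip}\,\mathscr H$; $c(E')$ is the number of connected components of $\mathrm{Bip}\,\mathscr H|_{E'}$. *)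

theory Defs
  imports Complex_Main "HOL-Library.FuncSet" "Graph_Theory.Digraph_Component"
begin

text \<open>
  The finite multiset of hyperedges is a family of vertex sets \<open>inc e\<close> indexed by a finite set \<open>E\<close>:
  equal hyperedges that occur several times have different indices, so that a function on the
  multiset is a function on \<open>E\<close>.
\<close>

locale hypergraph =
  fixes V :: "'v set" and E :: "'e set" and inc :: "'e \<Rightarrow> 'v set"
  assumes finite_vertices: "finite V"
    and finite_hyperedges: "finite E"
    and hyperedge_subset: "e \<in> E \<Longrightarrow> inc e \<subseteq> V"
    and hyperedge_nonempty: "e \<in> E \<Longrightarrow> inc e \<noteq> {}"

text \<open>
  Undirected graphs are symmetric digraphs, as in the locale \<open>pair_graph\<close>.  A connected
  graph has at least one vertex.
\<close>

definition bip :: "'v set \<Rightarrow> 'e set \<Rightarrow> ('e \<Rightarrow> 'v set) \<Rightarrow> ('v + 'e) pair_pre_digraph" where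
  "bip V E inc = \<lparr> pverts = V <+> E,
     parcs = (\<Union>e\<in>E. \<Union>v\<in>V \<inter> inc e. {(Inl v, Inr e), (Inr e, Inl v)}) \<rparr>"

definition bip_restrict :: "('e \<Rightarrow> 'v set) \<Rightarrow> 'e set \<Rightarrow> ('v + 'e) pair_pre_digraph" where
  "bip_restrict inc E' = bip (\<Union>e\<in>E'. inc e) E' inc"

text \<open>In a symmetric digraph the strongly connected components are the connected components.\<close>

definition num_components :: "'a pair_pre_digraph \<Rightarrow> nat" where
  "num_components G = card (pre_digraph.sccs (with_proj G))"

text \<open>
  The predicates \<open>forest\<close> and \<open>tree\<close> of \<open>Graph_Theory\<close> exclude directed cycles.  In a symmetric
  digraph every edge, traversed back and forth, is a directed cycle of length two, so they are not
  the notions for undirected graphs; the cycles of an undirected simple graph are the directed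
  cycles of length at least three.
\<close>

definition undirected_tree :: "'a pair_pre_digraph \<Rightarrow> bool" where
  "undirected_tree T \<longleftrightarrow> pair_graph T \<and> Digraph_Component.connected (with_proj T) \<and>
     (\<nexists>p. pre_digraph.cycle (with_proj T) p \<and> 3 \<le> length p)"

definition undirected_spanning_tree :: "'a pair_pre_digraph \<Rightarrow> 'a pair_pre_digraph \<Rightarrow> bool" where
  "undirected_spanning_tree T G \<longleftrightarrow> undirected_tree T \<and> spanning (with_proj T) (with_proj G)"

text \<open>In a symmetric digraph the degree of a vertex is its out-degree.\<close>

definition hypertree :: "'v set \<Rightarrow> 'e set \<Rightarrow> ('e \<Rightarrow> 'v set) \<Rightarrow> ('e \<Rightarrow> nat) \<Rightarrow> bool" where
  "hypertree V E inc f \<longleftrightarrow> (\<exists>T. undirected_spanning_tree T (bip V E inc) \<and>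
     (\<forall>e\<in>E. out_degree (with_proj T) (Inr e) = f e + 1))"

end

(*
  Edges are counted through components: a forest with m edges on n vertices has n - m components.
  Restricting a spanning tree to the hyperedges in E' gives a forest with at least c(E') components,
  whence the inequalities.  Conversely, only the consequence  sum f E' + 1 <= |Union E'|  of the
  inequalities is needed.  By an uncrossing argument, incidences can be deleted while it is preserved
  until every hyperedge e has exactly f e + 1 vertices.  The remaining bipartite graph is connected,
  because otherwise the inequalities for the two parts would contradict the equation, and it has
  |V| + |E| - 1 edges; so it is a spanning tree.
*)
theory Submission
  imports Defs
begin

section \<open>Counting components\<close>

text \<open>
  An undirected edge set is a relation \<open>B\<close> in which every edge occurs once, in an arbitrary
  orientation, so that \<open>card B\<close> counts edges; the vertex set \<open>V\<close> splits into the classes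
  \<open>V // linked B\<close>.  A set of edges is a forest iff every edge is a bridge.
\<close>

definition linked :: "'a rel \<Rightarrow> 'a rel" where
  "linked B = (B\<^sup>s)\<^sup>*"

definition forest_edges :: "'a rel \<Rightarrow> bool" where
  "forest_edges B \<longleftrightarrow> (\<forall>b\<in>B. b \<notin> linked (B - {b}))"

lemma in_symcl_iff: "(x, y) \<in> B\<^sup>s \<longleftrightarrow> (x, y) \<in> B \<or> (y, x) \<in> B"
  by (force simp: symcl_def)

lemma symcl_mono: "A \<subseteq> B \<Longrightarrow> A\<^sup>s \<subseteq> B\<^sup>s"
  by (auto simp: symcl_def)

lemma linked_mono: "A \<subseteq> B \<Longrightarrow> linked A \<subseteq> linked B"
  unfolding linked_def by (intro rtrancl_mono symcl_mono)

lemma linked_refl [simp]: "(x, x) \<in> linked B"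
  by (simp add: linked_def)

lemma linked_sym: "(x, y) \<in> linked B \<Longrightarrow> (y, x) \<in> linked B"
  unfolding linked_def by (rule symD[OF sym_rtrancl]) (auto simp: sym_def in_symcl_iff)

lemma linked_trans: "(x, y) \<in> linked B \<Longrightarrow> (y, z) \<in> linked B \<Longrightarrow> (x, z) \<in> linked B"
  unfolding linked_def by (rule rtrancl_trans)

lemma equiv_linked: "equiv UNIV (linked B)"
  by (auto simp: equiv_def refl_on_def sym_def trans_def intro: linked_sym linked_trans)

lemma linked_edge: "(x, y) \<in> B \<Longrightarrow> (x, y) \<in> linked B"
  by (auto simp: linked_def in_symcl_iff)

text \<open>A path through the new edge can be shortened so that it uses that edge only once, in one
  of its two directions.\<close>

lemma linked_insert:
  "linked (insert (u, v) B) = linked B \<union> {(x, y). (x, u) \<in> linked B \<and> (v, y) \<in> linked B}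
     \<union> {(x, y). (x, v) \<in> linked B \<and> (u, y) \<in> linked B}"
proof -
  have "(insert (u, v) B)\<^sup>s = insert (u, v) (insert (v, u) (B\<^sup>s))"
    by (auto simp: symcl_def)
  \<comment> \<open>\<open>rtrancl_insert\<close> is applied once for each orientation. The nested
    terms, in which both arcs occur, collapse by transitivity afterwards.\<close>
  then have "linked (insert (u, v) B) = linked B \<union> {(x, y). (x, v) \<in> linked B \<and> (u, y) \<in> linked B}
      \<union> {(x, y). (x, u) \<in> linked B \<union> {(x, y). (x, v) \<in> linked B \<and> (u, y) \<in> linked B}
           \<and> (v, y) \<in> linked B \<union> {(x, y). (x, v) \<in> linked B \<and> (u, y) \<in> linked B}}"
    by (simp add: linked_def rtrancl_insert)
  then have "(x, y) \<in> linked (insert (u, v) B) \<longleftrightarrow> (x, y) \<in> linked B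
      \<or> (x, u) \<in> linked B \<and> (v, y) \<in> linked B \<or> (x, v) \<in> linked B \<and> (u, y) \<in> linked B"
    for x y by simp (meson linked_trans)
  then show ?thesis by auto
qed

lemma linked_class_eq_iff: "linked B `` {x} = linked B `` {y} \<longleftrightarrow> (x, y) \<in> linked B"
  by (simp add: eq_equiv_class_iff[OF equiv_linked])

text \<open>An edge inside a class changes nothing. An edge between two classes merges these two
  into one and leaves all others alone. All counts of components and edges below rest on
  this.\<close>

lemma card_linked_insert:
  assumes "finite V" and "u \<in> V" and "v \<in> V"
  shows "card (V // linked B)
    = card (V // linked (insert (u, v) B)) + (if (u, v) \<in> linked B then 0 else 1)"
proof (cases "(u, v) \<in> linked B")
  case True
  then have "linked (insert (u, v) B) = linked B"
    unfolding linked_insert by (auto, (meson linked_trans linked_sym)+)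
  then show ?thesis using True by simp
next
  case False
  define L where "L = linked B"
  define L' where "L' = linked (insert (u, v) B)"
  define C where "C = L `` {u} \<union> L `` {v}"
  \<comment> \<open>\<open>C\<close> is the merged class: its points form one class of
    \<open>L'\<close>, and every other point keeps its old class.\<close>
  have cls: "L' `` {x} = (if x \<in> C then C else L `` {x})" for x
  proof (cases "x \<in> C")
    case True
    then have "(x, y) \<in> L' \<longleftrightarrow> y \<in> C" for y
      unfolding L'_def L_def C_def linked_insert by simp (meson linked_trans linked_sym)
    then show ?thesis using True by auto
  next
    case False
    then have "(x, u) \<notin> L" "(x, v) \<notin> L"
      unfolding L_def C_def using linked_sym by fastforce+
    then have "(x, y) \<in> L' \<longleftrightarrow> (x, y) \<in> L" for y
      unfolding L'_def L_def linked_insert by simp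
    then show ?thesis using False by auto
  qed
  have eq: "L `` {x} = L `` {u} \<or> L `` {x} = L `` {v} \<longleftrightarrow> x \<in> C" for x
    unfolding L_def C_def linked_class_eq_iff by (auto intro: linked_sym)
  have quot: "V // L' = insert C (V // L - {L `` {u}, L `` {v}})"
  proof -
    have "u \<in> C" by (simp add: C_def L_def)
    have "V // L' = (\<lambda>x. L' `` {x}) ` V" by (auto simp: quotient_def)
    also have "\<dots> = insert C ((\<lambda>x. L `` {x}) ` (V - C))"
      unfolding cls using assms(2) \<open>u \<in> C\<close> by (auto simp: image_iff split: if_splits)
    also have "(\<lambda>x. L `` {x}) ` (V - C) = V // L - {L `` {u}, L `` {v}}"
      using eq by (fastforce simp: quotient_def)
    finally show ?thesis .
  qed
  \<comment> \<open>An old class cannot contain both \<open>u\<close> and \<open>v\<close>. So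
    \<open>C\<close> is new, and inserting it in \<open>quot\<close> adds exactly one to the
    cardinality.\<close>
  have notin: "C \<notin> V // L"
  proof
    assume "C \<in> V // L"
    then obtain x where x: "C = L `` {x}" by (rule quotientE)
    moreover have "u \<in> C" "v \<in> C" by (simp_all add: C_def L_def)
    ultimately have "(x, u) \<in> L" "(x, v) \<in> L" by simp_all
    then show False using False unfolding L_def by (meson linked_trans linked_sym)
  qed
  have fin: "finite (V // L)" using assms(1) by (auto simp: quotient_def)
  have sub: "{L `` {u}, L `` {v}} \<subseteq> V // L" using assms by (auto simp: quotient_def)
  have two: "card {L `` {u}, L `` {v}} = 2"
    using False by (simp add: L_def linked_class_eq_iff)
  have "card (V // L') = card (V // L - {L `` {u}, L `` {v}}) + 1"
    unfolding quot using notin fin by simp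
  moreover have "card (V // L - {L `` {u}, L `` {v}}) = card (V // L) - 2"
    using card_Diff_subset[OF _ sub] two by simp
  \<comment> \<open>This makes the truncated subtraction of 2 exact.\<close>
  moreover have "2 \<le> card (V // L)"
    using card_mono[OF fin sub] two by simp
  ultimately have "card (V // L) = card (V // L') + 1" by simp
  then show ?thesis using False by (simp add: L_def L'_def)
qed

lemma card_linked_empty: "card (V // linked {}) = card V"
proof -
  have "V // linked {} = (\<lambda>x. {x}) ` V"
    by (auto simp: quotient_def linked_def symcl_def)
  then show ?thesis by (simp add: card_image)
qed

text \<open>Without edges every vertex is its own class, and each inserted edge lowers the number of
  classes by at most one.\<close>

lemma card_le_components_plus_edges:
  assumes "finite V" and "B \<subseteq> V \<times> V"
  shows "card V \<le> card (V // linked B) + card B"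
  using finite_subset[OF assms(2) finite_cartesian_product[OF assms(1,1)]] assms(2)
proof (induction B)
  case empty
  then show ?case by (simp add: card_linked_empty)
next
  case (insert b B)
  then show ?case
    using card_linked_insert[OF assms(1), of "fst b" "snd b" B] by (cases b) (auto split: if_splits)
qed

lemma forest_edges_subset: "forest_edges B \<Longrightarrow> A \<subseteq> B \<Longrightarrow> forest_edges A"
  unfolding forest_edges_def using linked_mono by (metis Diff_mono order_refl subset_iff)

text \<open>In a forest each inserted edge joins two different classes, so each lowers the number of
  classes by exactly one.\<close>

lemma card_eq_components_plus_edges:
  assumes "finite V" and "B \<subseteq> V \<times> V" and "forest_edges B"
  shows "card V = card (V // linked B) + card B"
  using finite_subset[OF assms(2) finite_cartesian_product[OF assms(1,1)]] assms(2-)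
proof (induction B)
  case empty
  then show ?case by (simp add: card_linked_empty)
next
  case (insert b B)
  have "b \<notin> linked B" using insert.prems(2) insert.hyps(2) by (auto simp: forest_edges_def)
  moreover have "forest_edges B" using insert.prems(2) forest_edges_subset by blast
  ultimately show ?case
    using insert card_linked_insert[OF assms(1), of "fst b" "snd b" B] by (cases b) auto
qed

text \<open>More edges give coarser classes: sending a class of \<open>linked A\<close> to the class
  of \<open>linked B\<close> around it is onto.\<close>

lemma card_linked_antimono:
  assumes "finite V" and "A \<subseteq> B"
  shows "card (V // linked B) \<le> card (V // linked A)"
proof -
  have "linked B `` (linked A `` {x}) = linked B `` {x}" for x
    using linked_mono[OF assms(2)] by (blast intro: linked_trans linked_refl)
  then have "V // linked B = (\<lambda>C. linked B `` C) ` (V // linked A)"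
    by (auto simp: quotient_def image_iff)
  moreover have "finite (V // linked A)" using assms(1) by (auto simp: quotient_def)
  ultimately show ?thesis by (simp add: card_image_le)
qed

lemma card_linked_eq_1_iff:
  "card (V // linked B) = 1 \<longleftrightarrow> V \<noteq> {} \<and> (\<forall>x\<in>V. \<forall>y\<in>V. (x, y) \<in> linked B)"
proof
  assume "card (V // linked B) = 1"
  then obtain C where C: "V // linked B = {C}" by (auto simp: card_1_singleton_iff)
  then have "linked B `` {x} = C" if "x \<in> V" for x
    using quotientI[OF that, of "linked B"] C by simp
  moreover have "V \<noteq> {}" using C by (auto simp: quotient_def)
  ultimately show "V \<noteq> {} \<and> (\<forall>x\<in>V. \<forall>y\<in>V. (x, y) \<in> linked B)"
    unfolding linked_class_eq_iff[symmetric] by simp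
next
  assume *: "V \<noteq> {} \<and> (\<forall>x\<in>V. \<forall>y\<in>V. (x, y) \<in> linked B)"
  then obtain x where x: "x \<in> V" by blast
  have "V // linked B = {linked B `` {x}}"
    using * x linked_class_eq_iff[of B] by (auto simp: quotient_def)
  then show "card (V // linked B) = 1" by simp
qed

text \<open>If some edge were not a bridge, deleting it would keep a single class with fewer than
  \<open>card V - 1\<close> edges, against \<open>card_le_components_plus_edges\<close>.\<close>

lemma forest_edges_iff_card:
  assumes "finite V" and "B \<subseteq> V \<times> V" and "card (V // linked B) = 1"
  shows "forest_edges B \<longleftrightarrow> card V = card B + 1"
proof
  assume "forest_edges B"
  then show "card V = card B + 1" using card_eq_components_plus_edges assms by fastforce
next
  assume card: "card V = card B + 1"
  show "forest_edges B"
    unfolding forest_edges_def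
  proof (intro ballI notI)
    fix b assume b: "b \<in> B" "b \<in> linked (B - {b})"
    then have "card (V // linked (B - {b})) = 1"
      using card_linked_insert[OF assms(1), of "fst b" "snd b" "B - {b}"] assms(2,3)
      by (cases b) (auto simp: insert_absorb)
    moreover have "card (B - {b}) < card B"
      using b(1) finite_subset[OF assms(2)] assms(1) by (intro card_Diff1_less) auto
    ultimately show False
      using card_le_components_plus_edges[of V "B - {b}"] assms(1,2) card by auto
  qed
qed

text \<open>An edge lies on a cycle of length at least three iff its ends stay joined after both of
  its arcs are removed. This links the cycles of the digraph library to the bridges in
  \<open>forest_edges\<close>.\<close>

lemma cycle_free_iff_bridges:
  assumes "pair_graph T"
  shows "(\<nexists>p. pre_digraph.cycle (with_proj T) p \<and> 3 \<le> length p)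
    \<longleftrightarrow> (\<forall>(u, v) \<in> parcs T. (u, v) \<notin> (parcs T - {(u, v), (v, u)})\<^sup>*)"
proof -
  interpret pair_graph T by fact
  have cyc: "\<exists>p. cycle p \<and> 3 \<le> length p"
    if uv: "(u, v) \<in> parcs T" and walk: "(u, v) \<in> (parcs T - {(u, v), (v, u)})\<^sup>*" for u v
  proof -
    define S where "S = \<lparr>pverts = pverts T, parcs = parcs T - {(u, v), (v, u)}\<rparr>"
    interpret S: pair_wf_digraph S
      by unfold_locales (auto simp: S_def in_arcsD1 in_arcsD2)
    have "u \<rightarrow>\<^sup>*\<^bsub>with_proj S\<^esub> v"
      using walk uv in_arcsD1 by (subst S.reachable_conv') (auto simp: S_def)
    then obtain p where p: "S.apath u p v" by (auto simp: S.reachable_apath)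
    have "u \<noteq> v" using uv no_loops' by blast
    have dist: "distinct (pawalk_verts u p)" and "S.awalk u p v"
      using p by (auto simp: S.apath_def)
    then have "set p \<subseteq> parcs S" and cas: "pcas u p v"
      unfolding S.awalk_def by auto
    then have arcs: "set p \<subseteq> parcs T - {(u, v), (v, u)}"
      by (simp add: S_def)
    have "awalk u p v" using arcs cas uv in_arcsD1 by (auto simp: awalk_def)
    moreover have vu: "(v, u) \<in> parcs T" using uv arcs_symmetric by blast
    ultimately have walk': "awalk v ((v, u) # p) v"
      by (auto simp: awalk_Cons_iff)
    \<comment> \<open>\<open>p\<close> is not empty because \<open>u\<close> and \<open>v\<close>
      differ, and it is not a single arc because \<open>(u, v)\<close> has been removed.\<close>
    have "2 \<le> length p"
      using cas arcs \<open>u \<noteq> v\<close> by (cases p; cases "tl p") auto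
    moreover have "cycle ((v, u) # p)"
      unfolding cycle_def using walk' dist by auto
    ultimately show ?thesis by (intro exI[of _ "(v, u) # p"]) auto
  qed
  moreover have "\<exists>(u, v) \<in> parcs T. (u, v) \<in> (parcs T - {(u, v), (v, u)})\<^sup>*"
    if p: "cycle p" "3 \<le> length p" for p
  proof -
    obtain u where walk: "awalk u p u" and dist: "distinct (tl (pawalk_verts u p))"
      using p(1) by (auto simp: cycle_def)
    obtain a q where pq: "p = a # q" using p(2) by (cases p) auto
    obtain v where a: "a = (u, v)" using walk pq by (cases a) (auto simp: awalk_Cons_iff)
    have q: "awalk v q u" and uv: "(u, v) \<in> parcs T"
      using walk pq a by (auto simp: awalk_Cons_iff)
    have dq: "distinct (pawalk_verts v q)" using dist pq a by simp
    have "2 \<le> length q" using p(2) pq by simp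
    have cas: "pcas v q u" and "q \<noteq> []" using q \<open>2 \<le> length q\<close> by auto
    \<comment> \<open>The vertices of \<open>q\<close> are listed in two ways: as its tails followed
      by \<open>u\<close>, and as \<open>v\<close> followed by its heads. By distinctness no arc of
      \<open>q\<close> starts in \<open>u\<close> and none ends in \<open>v\<close>.\<close>
    have verts: "map fst q @ [u] = pawalk_verts v q"
      using awalk_verts_conv[of v q] q \<open>q \<noteq> []\<close> by (auto simp: awalk_verts_conv)
    have verts': "v # map snd q = pawalk_verts v q"
      using awalk_verts_conv'[OF cas] \<open>q \<noteq> []\<close> cas by (cases q) auto
    have dfst: "distinct (map fst q @ [u])" and dsnd: "distinct (v # map snd q)"
      using dq verts verts' by simp_all
    have "(u, v) \<notin> set q" using dfst by force
    \<comment> \<open>Only the first arc of \<open>q\<close> has tail \<open>v\<close> and only the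
      last has head \<open>u\<close>, so \<open>(v, u)\<close> would be all of \<open>q\<close>,
      which has at least two arcs.\<close>
    moreover have "(v, u) \<notin> set q"
    proof
      assume "(v, u) \<in> set q"
      then obtain r1 r2 where r: "q = r1 @ (v, u) # r2" by (meson split_list)
      have "r1 = []" using r cas dfst by (cases r1) auto
      moreover have "r2 = []"
      proof (rule ccontr)
        assume "r2 \<noteq> []"
        then have "snd (last q) = u" "last q \<in> set r2"
          using arg_cong[OF trans[OF verts verts'[symmetric]], of last] r
          by (simp_all add: last_map)
        then show False using r dsnd by (auto intro: rev_image_eqI)
      qed
      ultimately show False using r \<open>2 \<le> length q\<close> by simp
    qed
    ultimately have sub: "set q \<subseteq> parcs T - {(u, v), (v, u)}" using q by auto
    have "pcas x q y \<Longrightarrow> set q \<subseteq> R \<Longrightarrow> (x, y) \<in> R\<^sup>*" for x y q and R :: "'a rel"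
      by (induction q arbitrary: x) (auto intro: converse_rtrancl_into_rtrancl)
    then have "(v, u) \<in> (parcs T - {(u, v), (v, u)})\<^sup>*" using q sub by blast
    moreover have "sym (parcs T - {(u, v), (v, u)})" using arcs_symmetric by (auto simp: sym_def)
    ultimately have "(u, v) \<in> (parcs T - {(u, v), (v, u)})\<^sup>*" by (meson sym_rtrancl symD)
    then show ?thesis using uv by blast
  qed
  ultimately show ?thesis by blast
qed

section \<open>Incidence graphs\<close>

text \<open>Each incidence is recorded once, oriented from the vertex to the hyperedge, so that
  cardinality counts undirected edges and no reversed pair occurs.\<close>

definition incidences :: "'e set \<Rightarrow> ('e \<Rightarrow> 'v set) \<Rightarrow> ('v + 'e) rel" where
  "incidences E inc = (\<Union>e\<in>E. \<Union>v\<in>inc e. {(Inl v, Inr e)})"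

lemma in_incidences_iff: "(x, y) \<in> incidences E inc \<longleftrightarrow> (\<exists>e\<in>E. \<exists>v\<in>inc e. x = Inl v \<and> y = Inr e)"
  by (auto simp: incidences_def)

lemma incidences_subset:
  assumes "\<And>e. e \<in> E \<Longrightarrow> inc e \<subseteq> V"
  shows "incidences E inc \<subseteq> (V <+> E) \<times> (V <+> E)"
  using assms by (fastforce simp: incidences_def)

lemma incidences_mono:
  assumes "E' \<subseteq> E" and "\<And>e. e \<in> E' \<Longrightarrow> inc' e \<subseteq> inc e"
  shows "incidences E' inc' \<subseteq> incidences E inc"
  using assms by (fastforce simp: incidences_def)

lemma card_incidences:
  fixes inc :: "'e \<Rightarrow> 'v set"
  assumes "finite E" and "\<And>e. e \<in> E \<Longrightarrow> finite (inc e)"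
  shows "card (incidences E inc) = (\<Sum>e\<in>E. card (inc e))"
proof -
  have "incidences E inc = (\<lambda>(e, v). (Inl v, Inr e)) ` Sigma E inc"
    by (auto simp: incidences_def)
  moreover have "inj_on (\<lambda>(e, v). (Inl v, Inr e) :: ('v + 'e) \<times> ('v + 'e)) (Sigma E inc)"
    by (auto simp: inj_on_def)
  ultimately have "card (incidences E inc) = card (Sigma E inc)"
    by (simp add: card_image)
  then show ?thesis using assms by (simp add: card_SigmaI)
qed

lemma card_incidences_degree:
  assumes "finite E" and deg: "\<And>e. e \<in> E \<Longrightarrow> card (inc e) = f e + 1"
  shows "card (incidences E inc) = sum f E + card E"
proof -
  \<comment> \<open>The summand 1 makes the cardinality positive, whereas an infinite set has
    cardinality 0.\<close>
  have "finite (inc e)" if "e \<in> E" for e using deg[OF that] card_ge_0_finite by force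
  then have "card (incidences E inc) = (\<Sum>e\<in>E. card (inc e))"
    using assms(1) by (intro card_incidences)
  also have "\<dots> = (\<Sum>e\<in>E. f e + 1)" using deg by (intro sum.cong) auto
  finally show ?thesis by (simp only: sum.distrib card_eq_sum)
qed

section \<open>Translating the bipartite digraph into its set of incidences\<close>

lemma pverts_bip [simp]: "pverts (bip V E inc) = V <+> E"
  by (simp add: bip_def)

lemma parcs_bip:
  assumes "\<And>e. e \<in> E \<Longrightarrow> inc e \<subseteq> V"
  shows "parcs (bip V E inc) = (incidences E inc)\<^sup>s"
proof -
  have "(x, y) \<in> parcs (bip V E inc) \<longleftrightarrow> (x, y) \<in> (incidences E inc)\<^sup>s" for x y
    unfolding in_symcl_iff in_incidences_iff using assms by (simp add: bip_def) blast
  then show ?thesis by auto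
qed

lemma pair_graph_bip:
  assumes "finite V" and "finite E"
  shows "pair_graph (bip V E inc)"
proof
  fix e assume "e \<in> parcs (bip V E inc)"
  then show "fst e \<in> pverts (bip V E inc)" "snd e \<in> pverts (bip V E inc)" "fst e \<noteq> snd e"
    by (auto simp: bip_def)
next
  show "finite (pverts (bip V E inc))" "finite (parcs (bip V E inc))"
    using assms by (auto simp: bip_def)
  show "symmetric (with_proj (bip V E inc))"
    by (auto simp: bip_def symmetric_def sym_def)
qed

text \<open>As the arc set is the symmetric closure of \<open>B\<close>, reachability is
  \<open>linked B\<close>, and the vertex sets of the strongly connected components are its
  classes.\<close>

lemma num_components_eq_card_linked:
  assumes "pair_graph G" and "parcs G = B\<^sup>s"
  shows "num_components G = card (pverts G // linked B)"
proof -
  interpret pair_graph G by fact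
  have "scc_of x = linked B `` {x}" if "x \<in> pverts G" for x
  proof -
    have "x \<rightarrow>\<^sup>*\<^bsub>with_proj G\<^esub> y \<longleftrightarrow> (x, y) \<in> linked B" for y
      unfolding linked_def assms(2)[symmetric] using that by (rule reachable_conv')
    then show ?thesis
      using symmetric_reachable' unfolding scc_of_def by blast
  qed
  then have "sccs_verts = pverts G // linked B"
    unfolding sccs_verts_conv_scc_of quotient_def by auto
  then show ?thesis by (simp add: num_components_def card_sccs_verts[symmetric])
qed

lemma connected_iff_card_linked:
  assumes "pair_graph G" and "parcs G = B\<^sup>s"
  shows "Digraph_Component.connected (with_proj G) \<longleftrightarrow> card (pverts G // linked B) = 1"
proof -
  interpret pair_graph G by fact
  \<comment> \<open>Library connectedness is reachability along the symmetric closure of the arcs,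
    which here is the arc set itself.\<close>
  have "(parcs G)\<^sup>s = parcs G"
    using arcs_symmetric by (auto simp: symcl_def)
  then have "Digraph_Component.connected (with_proj G) \<longleftrightarrow> strongly_connected (with_proj G)"
    by (simp add: connected_conv strongly_connected_def reachable_def)
  also have "\<dots> \<longleftrightarrow> pverts G \<noteq> {} \<and> (\<forall>x\<in>pverts G. \<forall>y\<in>pverts G. (x, y) \<in> linked B)"
    using reachable_conv' by (simp add: strongly_connected_def linked_def assms(2)[symmetric])
  finally show ?thesis unfolding card_linked_eq_1_iff .
qed

text \<open>The bridge criterion removes both arcs of an edge, \<open>forest_edges\<close> one
  oriented pair. They agree since all incidences point from \<open>Inl\<close> to
  \<open>Inr\<close>, so removing one pair removes exactly two arcs from the symmetric
  closure.\<close>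

lemma undirected_tree_bip_iff:
  assumes "finite V" and "finite E" and sub: "\<And>e. e \<in> E \<Longrightarrow> inc e \<subseteq> V"
  shows "undirected_tree (bip V E inc)
    \<longleftrightarrow> card ((V <+> E) // linked (incidences E inc)) = 1 \<and> forest_edges (incidences E inc)"
proof -
  let ?I = "incidences E inc"
  have rem: "(?I - {(u, v)})\<^sup>s = ?I\<^sup>s - {(u, v), (v, u)}" if "(u, v) \<in> ?I" for u v
  proof -
    have "(v, u) \<notin> ?I" using that by (auto simp: in_incidences_iff)
    then have "(x, y) \<in> (?I - {(u, v)})\<^sup>s \<longleftrightarrow> (x, y) \<in> ?I\<^sup>s - {(u, v), (v, u)}" for x y
      using that by (auto simp: in_symcl_iff)
    then show ?thesis by auto
  qed
  have "(\<forall>(u, v) \<in> ?I\<^sup>s. (u, v) \<notin> (?I\<^sup>s - {(u, v), (v, u)})\<^sup>*) \<longleftrightarrow> forest_edges ?I"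
  proof
    assume *: "\<forall>(u, v) \<in> ?I\<^sup>s. (u, v) \<notin> (?I\<^sup>s - {(u, v), (v, u)})\<^sup>*"
    show "forest_edges ?I"
      unfolding forest_edges_def linked_def
    proof
      fix b assume b: "b \<in> ?I"
      obtain u v where uv: "b = (u, v)" by (cases b)
      then have "(u, v) \<in> ?I\<^sup>s" using b by (simp add: in_symcl_iff)
      then show "b \<notin> ((?I - {b})\<^sup>s)\<^sup>*" using * rem b uv by auto
    qed
  next
    assume f: "forest_edges ?I"
    have "(u, v) \<notin> (?I\<^sup>s - {(u, v), (v, u)})\<^sup>*" if "(u, v) \<in> ?I\<^sup>s" for u v
    proof (cases "(u, v) \<in> ?I")
      case True
      then show ?thesis using f rem by (auto simp: forest_edges_def linked_def)
    next
      case False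
      then have vu: "(v, u) \<in> ?I" using that by (simp add: in_symcl_iff)
      then have "(v, u) \<notin> linked (?I - {(v, u)})" using f by (auto simp: forest_edges_def)
      then have "(u, v) \<notin> linked (?I - {(v, u)})" using linked_sym[of u v] by blast
      then show ?thesis using rem[OF vu] by (simp add: linked_def insert_commute)
    qed
    then show "\<forall>(u, v) \<in> ?I\<^sup>s. (u, v) \<notin> (?I\<^sup>s - {(u, v), (v, u)})\<^sup>*" by blast
  qed
  then show ?thesis
    using pair_graph_bip[OF assms(1,2), of inc] cycle_free_iff_bridges[of "bip V E inc"]
      connected_iff_card_linked[of "bip V E inc", OF _ parcs_bip[OF sub]]
    by (simp add: undirected_tree_def parcs_bip[OF sub])
qed

lemma out_degree_bip:
  assumes "e \<in> E" and "inc e \<subseteq> V"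
  shows "out_degree (with_proj (bip V E inc)) (Inr e) = card (inc e)"
proof -
  have "out_arcs (with_proj (bip V E inc)) (Inr e) = (\<lambda>v. (Inr e, Inl v)) ` inc e"
    using assms by (auto simp: bip_def out_arcs_def)
  moreover have "card ((\<lambda>v. (Inr e, Inl v)) ` inc e) = card (inc e)"
    by (rule card_image) (auto simp: inj_on_def)
  ultimately show ?thesis by (simp add: out_degree_def)
qed

text \<open>A spanning subgraph keeps all vertices, and by symmetry its arcs from vertices to
  hyperedges determine the rest; \<open>inc'\<close> reads them off.\<close>

lemma spanning_subgraph_bipE:
  assumes "pair_graph T" and "spanning (with_proj T) (with_proj (bip V E inc))"
  obtains inc' where "\<And>e. inc' e \<subseteq> V \<inter> inc e" and "T = bip V E inc'"
proof
  interpret pair_graph T by fact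
  define inc' where "inc' = (\<lambda>e. {v. (Inl v, Inr e) \<in> parcs T})"
  have verts: "pverts T = V <+> E" and arcs: "parcs T \<subseteq> parcs (bip V E inc)"
    using assms(2) by (auto simp: spanning_def subgraph_def)
  show sub: "inc' e \<subseteq> V \<inter> inc e" for e
    using arcs by (auto simp: inc'_def bip_def)
  have "(x, y) \<in> parcs T \<longleftrightarrow> (x, y) \<in> parcs (bip V E inc')" for x y
  proof
    assume xy: "(x, y) \<in> parcs T"
    then have "(y, x) \<in> parcs T" by (rule arcs_symmetric)
    with xy show "(x, y) \<in> parcs (bip V E inc')"
      using arcs by (auto simp: bip_def inc'_def)
  next
    assume "(x, y) \<in> parcs (bip V E inc')"
    then show "(x, y) \<in> parcs T"
      using arcs_symmetric by (auto simp: bip_def inc'_def)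
  qed
  then have "parcs T = parcs (bip V E inc')" by auto
  with verts show "T = bip V E inc'" by simp
qed

lemma spanning_bip:
  assumes "finite V" and "finite E" and "\<And>e. e \<in> E \<Longrightarrow> inc' e \<subseteq> inc e"
  shows "spanning (with_proj (bip V E inc')) (with_proj (bip V E inc))"
proof -
  have "wf_digraph (with_proj (bip V E i))" for i
    using pair_graph_bip[OF assms(1,2), of i] 
    by (simp add: wf_digraph_wp_iff pair_graph_def pair_digraph_def pair_fin_digraph_def)
  moreover have "parcs (bip V E inc') \<subseteq> parcs (bip V E inc)"
    using assms(3) by (fastforce simp: bip_def)
  ultimately show ?thesis
    unfolding spanning_def by (intro conjI subgraphI compatibleI_with_proj) simp_all
qed

text \<open>Spanning trees become choices of subsets \<open>inc' e\<close>, and degrees become their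
  cardinalities. From here on hypertrees are handled only in this form.\<close>

lemma hypertree_iff:
  assumes "hypergraph V E inc"
  shows "hypertree V E inc f \<longleftrightarrow> (\<exists>inc'. (\<forall>e\<in>E. inc' e \<subseteq> inc e \<and> card (inc' e) = f e + 1)
    \<and> card ((V <+> E) // linked (incidences E inc')) = 1 \<and> forest_edges (incidences E inc'))"
    (is "_ \<longleftrightarrow> ?R")
proof -
  interpret hypergraph V E inc by fact
  have fin: "finite V" "finite E" by (fact finite_vertices finite_hyperedges)+
  show ?thesis
  proof
    assume "hypertree V E inc f"
    then obtain T where T: "undirected_tree T" "spanning (with_proj T) (with_proj (bip V E inc))"
      and deg: "\<forall>e\<in>E. out_degree (with_proj T) (Inr e) = f e + 1"
      by (auto simp: hypertree_def undirected_spanning_tree_def)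
    from T(1) have "pair_graph T" by (simp add: undirected_tree_def)
    then obtain inc' where sub: "\<And>e. inc' e \<subseteq> V \<inter> inc e" and eq: "T = bip V E inc'"
      using spanning_subgraph_bipE[OF _ T(2)] by metis
    have "card (inc' e) = f e + 1" if "e \<in> E" for e
      using deg that sub[of e] out_degree_bip[of e E inc' V] by (auto simp: eq)
    moreover have "card ((V <+> E) // linked (incidences E inc')) = 1 \<and> forest_edges (incidences E inc')"
      using T(1) undirected_tree_bip_iff[OF fin, of inc'] sub unfolding eq by auto
    ultimately show ?R using sub by blast
  next
    assume ?R
    then obtain inc' where inc': "\<And>e. e \<in> E \<Longrightarrow> inc' e \<subseteq> inc e" "\<And>e. e \<in> E \<Longrightarrow> card (inc' e) = f e + 1"
      and tree: "card ((V <+> E) // linked (incidences E inc')) = 1" "forest_edges (incidences E inc')"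
      by blast
    have sub: "inc' e \<subseteq> V" if "e \<in> E" for e
      using inc'(1)[OF that] hyperedge_subset[OF that] by simp
    have "undirected_spanning_tree (bip V E inc') (bip V E inc)"
      using tree undirected_tree_bip_iff[OF fin sub] spanning_bip[OF fin inc'(1)]
      by (simp add: undirected_spanning_tree_def)
    moreover have "\<forall>e\<in>E. out_degree (with_proj (bip V E inc')) (Inr e) = f e + 1"
      using inc'(2) sub by (simp add: out_degree_bip)
    ultimately show "hypertree V E inc f"
      unfolding hypertree_def by blast
  qed
qed

section \<open>Deleting incidences\<close>

text \<open>This is a Hall condition with surplus one: the system of inequalities with c(E')
  weakened to 1. For constant \<open>f = 1\<close> it is the condition of Lovasz for forests of
  representatives.\<close>

definition strict_hall :: "'e set \<Rightarrow> ('e \<Rightarrow> 'v set) \<Rightarrow> ('e \<Rightarrow> nat) \<Rightarrow> bool" where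
  "strict_hall E inc f \<longleftrightarrow> (\<forall>A\<subseteq>E. A \<noteq> {} \<longrightarrow> sum f A + 1 \<le> card (\<Union>(inc ` A)))"

definition tight :: "('e \<Rightarrow> 'v set) \<Rightarrow> ('e \<Rightarrow> nat) \<Rightarrow> 'e set \<Rightarrow> bool" where
  "tight inc f A \<longleftrightarrow> card (\<Union>(inc ` A)) = sum f A + 1"

lemma strict_hallD:
  "strict_hall E inc f \<Longrightarrow> A \<subseteq> E \<Longrightarrow> A \<noteq> {} \<Longrightarrow> sum f A + 1 \<le> card (\<Union>(inc ` A))"
  by (simp add: strict_hall_def)

text \<open>Submodularity of \<open>\<lambda>A. card (\<Union>(inc ` A))\<close>.\<close>

lemma tight_Int:
  assumes "finite E" and fin: "\<And>e. e \<in> E \<Longrightarrow> finite (inc e)" and hall: "strict_hall E inc f"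
    and A: "A \<subseteq> E" "tight inc f A" and B: "B \<subseteq> E" "tight inc f B" and ne: "A \<inter> B \<noteq> {}"
  shows "tight inc f (A \<inter> B)"
proof -
  have finAB: "finite A" "finite B" using A(1) B(1) assms(1) finite_subset by auto
  have finU: "finite (\<Union>(inc ` A))" "finite (\<Union>(inc ` B))"
    using finAB fin A(1) B(1) by auto
  have "card (\<Union>(inc ` A)) + card (\<Union>(inc ` B))
      = card (\<Union>(inc ` (A \<union> B))) + card (\<Union>(inc ` A) \<inter> \<Union>(inc ` B))"
    unfolding image_Un Union_Un_distrib by (rule card_Un_Int[OF finU])
  moreover have "card (\<Union>(inc ` (A \<inter> B))) \<le> card (\<Union>(inc ` A) \<inter> \<Union>(inc ` B))"
    using finU by (intro card_mono) auto
  moreover have "sum f (A \<union> B) + sum f (A \<inter> B) = sum f A + sum f B"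
    by (rule sum.union_inter[OF finAB])
  moreover have "sum f (A \<union> B) + 1 \<le> card (\<Union>(inc ` (A \<union> B)))"
    using A(1) B(1) ne by (intro strict_hallD[OF hall]) auto
  \<comment> \<open>The common hyperedge makes the bound available for the intersection. With the
    bound for the union it leaves no slack in submodularity, so both are attained.\<close>
  moreover have "sum f (A \<inter> B) + 1 \<le> card (\<Union>(inc ` (A \<inter> B)))"
    using A(1) ne by (intro strict_hallD[OF hall]) auto
  ultimately show ?thesis using A(2) B(2) unfolding tight_def by linarith
qed

text \<open>
  If no \<open>v \<in> inc e\<close> can be removed, each \<open>v\<close> has a tight set through \<open>e\<close> in which \<open>e\<close> is the only
  hyperedge containing \<open>v\<close>.  The smallest tight set \<open>I\<close> through \<open>e\<close> lies in all of these, so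
  \<open>inc e\<close> is disjoint from the other members of \<open>I\<close>, which makes \<open>f e\<close> too large.
\<close>

lemma strict_hall_remove_incidence:
  assumes "finite E" and fin: "\<And>e. e \<in> E \<Longrightarrow> finite (inc e)" and hall: "strict_hall E inc f"
    and e: "e \<in> E" and big: "card (inc e) \<noteq> f e + 1"
  shows "\<exists>v\<in>inc e. strict_hall E (inc(e := inc e - {v})) f"
proof (rule ccontr)
  assume contra: "\<not> ?thesis"
  have big': "f e + 2 \<le> card (inc e)"
    using strict_hallD[OF hall, of "{e}"] e big by simp
  have ex: "\<exists>A\<subseteq>E. tight inc f A \<and> e \<in> A \<and> v \<notin> \<Union>(inc ` (A - {e}))" if v: "v \<in> inc e" for v
  proof -
    define inc' where "inc' = inc(e := inc e - {v})"
    have "\<not> strict_hall E inc' f" using contra v unfolding inc'_def by blast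
    \<comment> \<open>\<open>A\<close> violates the condition once \<open>v\<close> has left
      \<open>inc e\<close>. It must contain \<open>e\<close> and its union must lose
      \<open>v\<close>, since otherwise that union is unchanged. The loss is only one vertex, so
      \<open>A\<close> was tight.\<close>
    then obtain A where A: "A \<subseteq> E" "A \<noteq> {}" and less: "card (\<Union>(inc' ` A)) < sum f A + 1"
      unfolding strict_hall_def not_all not_imp not_le by blast
    have finA: "finite A" using A(1) assms(1) finite_subset by auto
    have finU: "finite (\<Union>(inc ` A))" using finA fin A(1) by auto
    have sub: "\<Union>(inc' ` A) \<subseteq> \<Union>(inc ` A)" by (auto simp: inc'_def split: if_splits)
    have hA: "sum f A + 1 \<le> card (\<Union>(inc ` A))" by (rule strict_hallD[OF hall A])
    have eA: "e \<in> A"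
    proof (rule ccontr)
      assume "e \<notin> A"
      then have "\<Union>(inc' ` A) = \<Union>(inc ` A)" by (auto simp: inc'_def)
      then show False using less hA by simp
    qed
    have sub': "\<Union>(inc ` A) \<subseteq> insert v (\<Union>(inc' ` A))"
      by (auto simp: inc'_def)
    have v': "v \<notin> \<Union>(inc' ` A)"
    proof
      assume "v \<in> \<Union>(inc' ` A)"
      then have "\<Union>(inc ` A) = \<Union>(inc' ` A)" using sub sub' by blast
      then show False using less hA by simp
    qed
    have "card (\<Union>(inc ` A)) \<le> card (\<Union>(inc' ` A)) + 1"
      using card_mono[OF _ sub'] finite_subset[OF sub finU] v' by simp
    then have "tight inc f A" using less hA by (simp add: tight_def)
    moreover have "v \<notin> \<Union>(inc ` (A - {e}))" using v' by (auto simp: inc'_def)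
    ultimately show ?thesis using A(1) eA by blast
  qed
  let ?P = "\<lambda>A. A \<subseteq> E \<and> tight inc f A \<and> e \<in> A"
  have "inc e \<noteq> {}" using big' by auto
  then have "\<exists>A. ?P A" using ex by blast
  then obtain I where I: "?P I" and min: "\<And>A. ?P A \<Longrightarrow> card I \<le> card A"
    using ex_has_least_nat[of ?P _ card] by metis
  have finI: "finite I" using I assms(1) finite_subset by blast
  have disj: "inc e \<inter> \<Union>(inc ` (I - {e})) = {}"
  proof -
    have "v \<notin> \<Union>(inc ` (I - {e}))" if v: "v \<in> inc e" for v
    proof -
      obtain A where A: "A \<subseteq> E" "tight inc f A" "e \<in> A" "v \<notin> \<Union>(inc ` (A - {e}))"
        using ex[OF v] by blast
      \<comment> \<open>Both sets contain \<open>e\<close>, so \<open>tight_Int\<close> applies, and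
        the least cardinality of \<open>I\<close> forces \<open>I\<close> into
        \<open>A\<close>.\<close>
      have "?P (I \<inter> A)" using tight_Int[OF assms(1) fin hall, of I A] I A by blast
      then have "I \<inter> A = I" using min finI by (intro card_seteq) auto
      then show ?thesis using A(4) by blast
    qed
    then show ?thesis by blast
  qed
  have "\<Union>(inc ` I) = inc e \<union> \<Union>(inc ` (I - {e}))" using I by blast
  moreover have "finite (inc e)" "finite (\<Union>(inc ` (I - {e})))" using fin e I finI by auto
  ultimately have card: "card (\<Union>(inc ` I)) = card (inc e) + card (\<Union>(inc ` (I - {e})))"
    using disj by (simp add: card_Un_disjoint)
  have sum: "sum f I = f e + sum f (I - {e})"
    using I finI by (simp add: sum.remove)
  show False
  proof (cases "I = {e}")
    case True
    then show ?thesis using I big by (simp add: tight_def)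
  next
    case False
    \<comment> \<open>By disjointness the union over \<open>I\<close> has at least
      \<open>f e + 2 + sum f (I - {e}) + 1\<close> elements, two more than tightness allows.\<close>
    then have "sum f (I - {e}) + 1 \<le> card (\<Union>(inc ` (I - {e})))"
      using I by (intro strict_hallD[OF hall]) auto
    then show ?thesis using card sum I big' by (simp add: tight_def)
  qed
qed

text \<open>Incidences are removed one at a time, by induction on their total number; the process
  stops only when every hyperedge has the prescribed size.\<close>

lemma strict_hall_shrink:
  assumes "finite E" and "\<And>e. e \<in> E \<Longrightarrow> finite (inc e)" and "strict_hall E inc f"
  shows "\<exists>inc'. (\<forall>e\<in>E. inc' e \<subseteq> inc e \<and> card (inc' e) = f e + 1) \<and> strict_hall E inc' f"
  using assms(2,3)
proof (induction "\<Sum>e\<in>E. card (inc e)" arbitrary: inc rule: less_induct)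
  case less
  show ?case
  proof (cases "\<forall>e\<in>E. card (inc e) = f e + 1")
    case True
    then show ?thesis using less.prems(2) by blast
  next
    case False
    then obtain e where e: "e \<in> E" "card (inc e) \<noteq> f e + 1" by blast
    obtain v where v: "v \<in> inc e" and hall: "strict_hall E (inc(e := inc e - {v})) f"
      using strict_hall_remove_incidence[OF assms(1) less.prems e] by blast
    let ?inc = "inc(e := inc e - {v})"
    have lt: "(\<Sum>x\<in>E. card (?inc x)) < (\<Sum>x\<in>E. card (inc x))"
      using assms(1) e(1) v less.prems(1)
        card_Diff1_less[OF less.prems(1)[OF e(1)] v]
      by (intro sum_strict_mono_ex1) (auto intro!: card_Diff1_le bexI[of _ e])
    have "finite (?inc x)" if "x \<in> E" for x using less.prems(1)[OF that] by auto
    from less.hyps[OF lt this hall] obtain inc'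
      where "\<forall>x\<in>E. inc' x \<subseteq> ?inc x \<and> card (inc' x) = f x + 1" "strict_hall E inc' f"
      by blast
    moreover have "?inc x \<subseteq> inc x" for x by auto
    ultimately show ?thesis by (meson subset_trans)
  qed
qed

section \<open>The hypertree polytope\<close>

text \<open>If some hyperedges lay outside one component, the bounds for those inside and those
  outside would add up to \<open>sum f E + 2 \<le> card V\<close>.\<close>

lemma strict_hall_imp_connected:
  assumes "finite V" and "finite E" and sub: "\<And>e. e \<in> E \<Longrightarrow> inc e \<subseteq> V"
    and hall: "strict_hall E inc f" and total: "sum f E + 1 = card V"
  shows "card ((V <+> E) // linked (incidences E inc)) = 1"
proof (cases "E = {}")
  case True
  then obtain v where "V = {v}" using total card_1_singletonE[of V] by auto
  then show ?thesis using True unfolding card_linked_eq_1_iff by auto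
next
  case False
  let ?L = "linked (incidences E inc)"
  \<comment> \<open>The bound for the whole of \<open>E\<close> forces the hyperedges to cover
    \<open>V\<close>, which excludes isolated vertices.\<close>
  have "\<Union>(inc ` E) \<subseteq> V" using sub by auto
  moreover have "card V \<le> card (\<Union>(inc ` E))"
    using strict_hallD[OF hall _ False] total by simp
  ultimately have cover: "\<Union>(inc ` E) = V"
    using card_seteq[OF assms(1)] by blast
  have edge: "(Inl v, Inr e) \<in> ?L" if "e \<in> E" "v \<in> inc e" for e v
    using that by (intro linked_edge) (auto simp: in_incidences_iff)
  obtain a where a: "a \<in> V" using total by fastforce
  \<comment> \<open>\<open>E1\<close> and \<open>V1\<close> are the hyperedges and the vertices in
    the component of \<open>a\<close>. No incidence crosses to the complements, so the two unions
    fit into \<open>V1\<close> and \<open>V - V1\<close>.\<close>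
  define E1 where "E1 = {e \<in> E. (Inl a, Inr e) \<in> ?L}"
  define V1 where "V1 = {v \<in> V. (Inl a, Inl v) \<in> ?L}"
  have "E1 \<noteq> {}" using a cover edge by (auto simp: E1_def)
  have 1: "\<Union>(inc ` E1) \<subseteq> V1"
  proof
    fix v assume "v \<in> \<Union>(inc ` E1)"
    then obtain e where e: "e \<in> E" "(Inl a, Inr e) \<in> ?L" "v \<in> inc e" by (auto simp: E1_def)
    then have "(Inl a, Inl v) \<in> ?L" by (meson edge linked_sym linked_trans)
    then show "v \<in> V1" using e sub by (auto simp: V1_def)
  qed
  have 2: "\<Union>(inc ` (E - E1)) \<subseteq> V - V1"
  proof
    fix v assume "v \<in> \<Union>(inc ` (E - E1))"
    then obtain e where e: "e \<in> E" "(Inl a, Inr e) \<notin> ?L" "v \<in> inc e" by (auto simp: E1_def)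
    then have "(Inl a, Inl v) \<notin> ?L" by (meson edge linked_trans)
    then show "v \<in> V - V1" using e sub by (auto simp: V1_def)
  qed
  have "E - E1 = {}"
  proof (rule ccontr)
    assume ne: "E - E1 \<noteq> {}"
    have "V1 \<subseteq> V" "E1 \<subseteq> E" by (auto simp: V1_def E1_def)
    have "sum f E1 + 1 \<le> card V1"
      using strict_hallD[OF hall \<open>E1 \<subseteq> E\<close> \<open>E1 \<noteq> {}\<close>]
        card_mono[OF finite_subset[OF \<open>V1 \<subseteq> V\<close> assms(1)] 1] by linarith
    moreover have "sum f (E - E1) + 1 \<le> card (V - V1)"
      using strict_hallD[OF hall _ ne] card_mono[OF finite_Diff[OF assms(1)] 2] by auto
    moreover have "sum f E = sum f (E - E1) + sum f E1"
      by (rule sum.subset_diff[OF \<open>E1 \<subseteq> E\<close> assms(2)])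
    moreover have "card (V - V1) = card V - card V1"
      using card_Diff_subset[OF finite_subset[OF \<open>V1 \<subseteq> V\<close> assms(1)] \<open>V1 \<subseteq> V\<close>] .
    ultimately show False using total by linarith
  qed
  then have *: "(Inl a, Inr e) \<in> ?L" if "e \<in> E" for e using that by (auto simp: E1_def)
  then have "(Inl a, Inl v) \<in> ?L" if "v \<in> V" for v
    using 1 cover that \<open>E - E1 = {}\<close> by (auto simp: V1_def)
  with * have all: "(Inl a, x) \<in> ?L" if "x \<in> V <+> E" for x using that by auto
  have "(x, y) \<in> ?L" if "x \<in> V <+> E" "y \<in> V <+> E" for x y
    using linked_trans[OF linked_sym[OF all[OF that(1)]] all[OF that(2)]] .
  then show ?thesis using a unfolding card_linked_eq_1_iff by blast
qed

section \<open>Necessity and sufficiency of the inequalities\<close>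

lemma num_components_bip_restrict:
  assumes "finite E'" and "\<And>e. e \<in> E' \<Longrightarrow> finite (inc e)"
  shows "num_components (bip_restrict inc E')
    = card ((\<Union>(inc ` E') <+> E') // linked (incidences E' inc))"
proof -
  let ?U = "\<Union>(inc ` E')"
  have "pair_graph (bip ?U E' inc)" using assms by (intro pair_graph_bip) auto
  moreover have "parcs (bip ?U E' inc) = (incidences E' inc)\<^sup>s" by (rule parcs_bip) auto
  ultimately show ?thesis
    using num_components_eq_card_linked[of "bip ?U E' inc"] by (simp add: bip_restrict_def)
qed

text \<open>The tree restricted to \<open>E'\<close> is a forest with
  \<open>sum f E' + card E'\<close> edges on \<open>card ?U + card E'\<close> vertices, which
  determines its number of components. It is a subgraph of the full restriction, so it has at least
  as many components. The additive form avoids truncated subtraction.\<close>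

lemma hypertree_sum_le:
  assumes "hypergraph V E inc" and "hypertree V E inc f" and "E' \<subseteq> E"
  shows "sum f E' + num_components (bip_restrict inc E') \<le> card (\<Union>(inc ` E'))"
proof -
  interpret hypergraph V E inc by fact
  obtain inc' where inc': "\<And>e. e \<in> E \<Longrightarrow> inc' e \<subseteq> inc e" "\<And>e. e \<in> E \<Longrightarrow> card (inc' e) = f e + 1"
    and forest: "forest_edges (incidences E inc')"
    using assms(2) unfolding hypertree_iff[OF assms(1)] by blast
  have finE: "finite E'" using assms(3) finite_hyperedges finite_subset by auto
  have fin: "finite (inc e)" if "e \<in> E'" for e
    using that assms(3) hyperedge_subset finite_vertices finite_subset by (metis subsetD)
  let ?U = "\<Union>(inc ` E')" and ?I = "incidences E' inc'"
  have finU: "finite ?U" using finE fin by auto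
  have "?I \<subseteq> (?U <+> E') \<times> (?U <+> E')"
    using inc'(1) assms(3) by (intro incidences_subset) blast
  moreover have "forest_edges ?I"
    using forest incidences_mono[OF assms(3) order_refl] by (rule forest_edges_subset)
  ultimately have "card (?U <+> E') = card ((?U <+> E') // linked ?I) + card ?I"
    using finE finU by (intro card_eq_components_plus_edges) simp_all
  moreover have "card ?I = sum f E' + card E'"
    using inc'(2) assms(3) by (intro card_incidences_degree[OF finE]) auto
  moreover have "card (?U <+> E') = card ?U + card E'"
    by (rule card_Plus[OF finU finE])
  moreover have "num_components (bip_restrict inc E') \<le> card ((?U <+> E') // linked ?I)"
  proof -
    have "num_components (bip_restrict inc E') = card ((?U <+> E') // linked (incidences E' inc))"
      using finE fin by (rule num_components_bip_restrict)
    then show ?thesis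
      using finE finU inc'(1) assms(3) card_linked_antimono[of "?U <+> E'" ?I "incidences E' inc"]
        incidences_mono[of E' E' inc' inc] by auto
  qed
  ultimately show ?thesis by linarith
qed

text \<open>A spanning tree has \<open>card V + card E - 1\<close> edges, and counting them at the
  hyperedges gives \<open>sum f E + card E\<close>.\<close>

lemma hypertree_sum_eq:
  assumes "hypergraph V E inc" and "hypertree V E inc f"
  shows "sum f E + 1 = card V"
proof -
  interpret hypergraph V E inc by fact
  obtain inc' where inc': "\<And>e. e \<in> E \<Longrightarrow> inc' e \<subseteq> inc e" "\<And>e. e \<in> E \<Longrightarrow> card (inc' e) = f e + 1"
    and conn: "card ((V <+> E) // linked (incidences E inc')) = 1"
    and forest: "forest_edges (incidences E inc')"
    using assms(2) unfolding hypertree_iff[OF assms(1)] by blast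
  have sub: "inc' e \<subseteq> V" if "e \<in> E" for e
    using inc'(1)[OF that] hyperedge_subset[OF that] by simp
  have "incidences E inc' \<subseteq> (V <+> E) \<times> (V <+> E)"
    using sub by (rule incidences_subset)
  then have iff: "forest_edges (incidences E inc') \<longleftrightarrow> card (V <+> E) = card (incidences E inc') + 1"
    using finite_vertices finite_hyperedges conn by (intro forest_edges_iff_card) auto
  have "card (incidences E inc') = sum f E + card E"
    using finite_hyperedges inc'(2) by (rule card_incidences_degree)
  moreover have "card (V <+> E) = card (incidences E inc') + 1"
    using iff forest by simp
  ultimately show ?thesis
    using card_Plus[OF finite_vertices finite_hyperedges] by simp
qed

text \<open>Shrinking fixes the degrees and keeps \<open>strict_hall\<close>, which gives
  connectedness. The number of edges then excludes cycles.\<close>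

lemma strict_hall_imp_hypertree:
  assumes "hypergraph V E inc" and "strict_hall E inc f" and total: "sum f E + 1 = card V"
  shows "hypertree V E inc f"
proof -
  interpret hypergraph V E inc by fact
  have "finite (inc e)" if "e \<in> E" for e
    using hyperedge_subset[OF that] finite_vertices by (rule finite_subset)
  then obtain inc' where inc': "\<And>e. e \<in> E \<Longrightarrow> inc' e \<subseteq> inc e" "\<And>e. e \<in> E \<Longrightarrow> card (inc' e) = f e + 1"
    and hall: "strict_hall E inc' f"
    using strict_hall_shrink[OF finite_hyperedges _ assms(2)] by metis
  have sub: "inc' e \<subseteq> V" if "e \<in> E" for e
    using inc'(1)[OF that] hyperedge_subset[OF that] by simp
  have conn: "card ((V <+> E) // linked (incidences E inc')) = 1"
    using finite_vertices finite_hyperedges sub hall total by (rule strict_hall_imp_connected)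
  have "incidences E inc' \<subseteq> (V <+> E) \<times> (V <+> E)"
    using sub by (rule incidences_subset)
  then have iff: "forest_edges (incidences E inc') \<longleftrightarrow> card (V <+> E) = card (incidences E inc') + 1"
    using finite_vertices finite_hyperedges conn by (intro forest_edges_iff_card) auto
  have "card (incidences E inc') = sum f E + card E"
    using finite_hyperedges inc'(2) by (rule card_incidences_degree)
  then have "card (V <+> E) = card (incidences E inc') + 1"
    using card_Plus[OF finite_vertices finite_hyperedges] total by simp
  then have "forest_edges (incidences E inc')"
    using iff by simp
  then show ?thesis
    unfolding hypertree_iff[OF assms(1)] using inc' conn by blast
qed

text \<open>This bound lets the given inequalities imply \<open>strict_hall\<close>.\<close>

lemma num_components_bip_restrict_pos:
  assumes "finite E'" and "\<And>e. e \<in> E' \<Longrightarrow> finite (inc e)" and "E' \<noteq> {}"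
  shows "1 \<le> num_components (bip_restrict inc E')"
proof -
  let ?Q = "(\<Union>(inc ` E') <+> E') // linked (incidences E' inc)"
  have "finite (\<Union>(inc ` E') <+> E')" using assms(1,2) by auto
  then have "finite ?Q" by (auto simp: quotient_def)
  moreover have "?Q \<noteq> {}" using assms(3) by (auto simp: quotient_def)
  ultimately have "card ?Q \<noteq> 0" by simp
  then show ?thesis
    by (subst num_components_bip_restrict[OF assms(1,2)]) simp_all
qed

text \<open>Functions are extensional on \<open>E\<close>, so that each point of the real vector
  space is represented once.\<close>

theorem theorem3p4:
  fixes V :: "'v set" and E :: "'e set" and inc :: "'e \<Rightarrow> 'v set"
  assumes "hypergraph V E inc"
    and "Digraph_Component.connected (with_proj (bip V E inc))"
  shows "(\<lambda>f. \<lambda>e\<in>E. real (f e)) ` {f \<in> E \<rightarrow>\<^sub>E (UNIV :: nat set). hypertree V E inc f}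
       = {x \<in> E \<rightarrow>\<^sub>E (\<int> :: real set).
            (\<forall>e\<in>E. 0 \<le> x e) \<and>
            (\<forall>E'. E' \<subseteq> E \<and> E' \<noteq> {} \<longrightarrow>
               (\<Sum>e\<in>E'. x e) \<le> real (card (\<Union>e\<in>E'. inc e)) - real (num_components (bip_restrict inc E'))) \<and>
            (\<Sum>e\<in>E. x e) = real (card V) - 1}"
    (is "?emb ` ?H = ?P")
proof
  interpret hypergraph V E inc by fact
  have sum_emb: "(\<Sum>e\<in>E'. ?emb f e) = real (sum f E')" if "E' \<subseteq> E" for E' and f :: "'e \<Rightarrow> nat"
    using that by (subst of_nat_sum) (auto intro!: sum.cong)
  show "?emb ` ?H \<subseteq> ?P"
  proof
    fix x assume "x \<in> ?emb ` ?H"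
    then obtain f where f: "hypertree V E inc f" and x: "x = ?emb f" by blast
    have "(\<Sum>e\<in>E'. x e) \<le> real (card (\<Union>e\<in>E'. inc e)) - real (num_components (bip_restrict inc E'))"
      if "E' \<subseteq> E" for E'
      using hypertree_sum_le[OF assms(1) f that] unfolding x sum_emb[OF that] by linarith
    moreover have "(\<Sum>e\<in>E. x e) = real (card V) - 1"
      using hypertree_sum_eq[OF assms(1) f] unfolding x sum_emb[OF order_refl] by linarith
    ultimately show "x \<in> ?P" using x by auto
  qed
  show "?P \<subseteq> ?emb ` ?H"
  proof
    fix x assume x: "x \<in> ?P"
    \<comment> \<open>The coordinates of \<open>x\<close> are nonnegative integers, so rounding to
      \<open>nat\<close> loses nothing. Restricting to \<open>E\<close> makes \<open>f\<close>
      extensional.\<close>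
    define f where "f = (\<lambda>e\<in>E. nat \<lfloor>x e\<rfloor>)"
    have f: "real (f e) = x e" if "e \<in> E" for e
    proof -
      have "x e \<in> \<int>" "0 \<le> x e" using x that by auto
      then show ?thesis using that by (auto simp: f_def elim!: Ints_cases)
    qed
    have "x \<in> extensional E" using x by (auto simp: PiE_def)
    then have emb: "?emb f = x"
      using f by (intro extensionalityI[of _ E]) auto
    have ineq: "real (sum f E') \<le> real (card (\<Union>(inc ` E'))) - real (num_components (bip_restrict inc E'))"
      if "E' \<subseteq> E" "E' \<noteq> {}" for E'
      using x that unfolding sum_emb[OF that(1), symmetric] emb by blast
    have total: "sum f E + 1 = card V"
    proof -
      have "real (sum f E) = real (card V) - 1"
        using x unfolding sum_emb[OF order_refl, symmetric] emb by blast
      then show ?thesis by linarith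
    qed
    have "strict_hall E inc f"
      unfolding strict_hall_def
    proof (intro allI impI)
      fix A assume A: "A \<subseteq> E" "A \<noteq> {}"
      have finA: "finite A" using A(1) finite_hyperedges by (rule finite_subset)
      have finI: "finite (inc e)" if "e \<in> A" for e
        using hyperedge_subset finite_vertices A(1) that by (meson finite_subset subsetD)
      show "sum f A + 1 \<le> card (\<Union>(inc ` A))"
        using ineq[OF A] num_components_bip_restrict_pos[of A inc, OF finA finI A(2)] by linarith
    qed
    then have "hypertree V E inc f"
      using assms(1) total by (intro strict_hall_imp_hypertree)
    then have "f \<in> ?H" by (simp add: f_def)
    then show "x \<in> ?emb ` ?H" using emb by (intro rev_image_eqI[of f]) simp_all
  qed
qed

end
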